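(* Let $w\in[-1,1]$ with $w\neq0$ and let $v\in\mathbb{C}$ be such that $\frac{v}{w}\notin(-i\infty,-i]\cup[i,i\infty)$. Let $$R=\frac{v/w}{1+\sqrt{1+(v/w)^2}},\qquad S=iw+\sqrt{1-w^2}.$$ Then $$\begin{aligned}\mathrm{TS}(v,w)=\;&2F_3(R)-F_3(RS)-F_3(R/S)-4F_{1,2}(R,1)+2F_{1,2}(R,S)+2F_{1,2}(R,1/S)\\&+i\sin^{-1}(w)\left\{F_2(RS)-F_2(R/S)-2F_{1,1}(R,S)+2F_{1,1}(R,1/S)\right\}.\end{aligned}$$
   Context: The function $\mathrm{TS}$ is $\mathrm{TS}(v,w)=\int_0^1\frac{\tan^{-1}(vx)\sin^{-1}(wx)}{x}\,dx$, with principal branches. The functions $F_j$ and $F_{j,k}$ are $F_j(x)=\sum_{n=0}^\infty\frac{x^{2n+1}}{(2n+1)^j}$ and $F_{j,k}(x,y)=\sum_{n=0}^\infty\frac{x^{2n+1}}{(2n+1)^j}\sum_{m=0}^n\frac{y^{2m+1}}{(2m+1)^k}$. The square roots are principal; $(-i\infty,-i]\cup[i,i\infty)$ denotes $\{it: t\in\mathbb{R},|t|\ge1\}$. *)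

theory Defs
  imports "HOL-Analysis.Analysis"
begin

text \<open>At the endpoint \<open>x = 0\<close> the integrand takes the value \<open>0\<close>, since \<open>0 / 0 = 0\<close>;
  this does not affect the integral.\<close>

definition TS :: "complex \<Rightarrow> complex \<Rightarrow> complex" where
  "TS v w = integral {0..1}
     (\<lambda>x::real. Arctan (v * of_real x) * Arcsin (w * of_real x) / of_real x)"

definition F :: "nat \<Rightarrow> complex \<Rightarrow> complex" where
  "F j x = (\<Sum>n. x ^ (2 * n + 1) / of_nat (2 * n + 1) ^ j)"

definition FF :: "nat \<Rightarrow> nat \<Rightarrow> complex \<Rightarrow> complex \<Rightarrow> complex" where
  "FF j k x y = (\<Sum>n. x ^ (2 * n + 1) / of_nat (2 * n + 1) ^ j *
     (\<Sum>m\<le>n. y ^ (2 * m + 1) / of_nat (2 * m + 1) ^ k))"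

end

theory Submission
  imports Defs
begin

text \<open>
  Since \<open>v / w = 2 R / (1 - R\<^sup>2)\<close> with \<open>\<bar>R\<bar> < 1\<close>, the addition formula for the arctangent gives
  \<open>Arctan ((v / w) sin t) = 2 \<Sum>n. R\<^bsup>2 n + 1\<^esup> sin ((2 n + 1) t) / (2 n + 1)\<close>. Substitute \<open>w x = sin t\<close>
  in the integral, so that \<open>dx / x = cos t / sin t dt\<close>, and integrate termwise. The quotient
  \<open>sin ((2 n + 1) t) / sin t\<close> is a Dirichlet kernel, and multiplied by \<open>cos t\<close> it becomes
  \<open>2 (\<Sum>m\<le>n. cos ((2 m + 1) t)) - cos ((2 n + 1) t)\<close>; integrating this against \<open>t\<close> up to
  \<open>arcsin w\<close> is elementary. The claim follows because \<open>S = cis (arcsin w)\<close>.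
\<close>

section \<open>The Dirichlet kernel\<close>

text \<open>The cosine sum avoids dividing by \<open>sin t\<close>, so the kernel is continuous also
  at \<open>t = 0\<close>.\<close>

definition dirichlet_kernel :: "nat \<Rightarrow> real \<Rightarrow> real" where
  "dirichlet_kernel n t = 1 + 2 * (\<Sum>k<n. cos (2 * real (k + 1) * t))"

lemma sin_times_dirichlet_kernel:
  "sin t * dirichlet_kernel n t = sin (real (2 * n + 1) * t)"
proof (induction n)
  case 0
  show ?case by (simp add: dirichlet_kernel_def)
next
  case (Suc n)
  have "2 * (sin t * cos (2 * real (n + 1) * t))
      = sin (real (2 * Suc n + 1) * t) - sin (real (2 * n + 1) * t)"
    using sin_minus[of "t + t * (2 * real n)"]
    by (simp add: sin_times_cos field_simps)
  with Suc show ?case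
    by (simp add: dirichlet_kernel_def algebra_simps)
qed

text \<open>By the product-to-sum formula every odd cosine arises twice, from two neighbouring terms
  of the kernel, except the highest, which arises once.\<close>

lemma cos_times_dirichlet_kernel:
  "cos t * dirichlet_kernel n t
     = 2 * (\<Sum>m\<le>n. cos (real (2 * m + 1) * t)) - cos (real (2 * n + 1) * t)"
proof (induction n)
  case 0
  show ?case by (simp add: dirichlet_kernel_def)
next
  case (Suc n)
  have "2 * (cos t * cos (2 * real (n + 1) * t))
      = cos (real (2 * Suc n + 1) * t) + cos (real (2 * n + 1) * t)"
    using cos_minus[of "t + t * (2 * real n)"]
    by (simp add: cos_times_cos algebra_simps)
  with Suc show ?case
    by (simp add: dirichlet_kernel_def algebra_simps)
qed

lemma abs_dirichlet_kernel_le: "\<bar>dirichlet_kernel n t\<bar> \<le> real (2 * n + 1)"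
proof -
  have "\<bar>\<Sum>k<n. cos (2 * real (k + 1) * t)\<bar> \<le> (\<Sum>k<n. 1)"
    by (rule order_trans[OF sum_abs sum_mono]) simp
  then show ?thesis by (simp add: dirichlet_kernel_def)
qed

lemma continuous_on_dirichlet_kernel [continuous_intros]:
  fixes f :: "'a::t2_space \<Rightarrow> real"
  shows "continuous_on A f \<Longrightarrow> continuous_on A (\<lambda>x. dirichlet_kernel n (f x))"
  unfolding dirichlet_kernel_def by (intro continuous_intros)

section \<open>Antiderivatives of the moments\<close>

text \<open>Integration by parts of \<open>t * cos ((2 m + 1) t)\<close>; the \<open>- 1\<close>
  makes the antiderivative vanish at \<open>0\<close>, so no boundary term is left there.\<close>

definition cos_moment :: "nat \<Rightarrow> real \<Rightarrow> real" where
  "cos_moment m t = t * sin (real (2 * m + 1) * t) / real (2 * m + 1)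
     + (cos (real (2 * m + 1) * t) - 1) / (real (2 * m + 1))\<^sup>2"

lemma cos_moment_0 [simp]: "cos_moment m 0 = 0"
  by (simp add: cos_moment_def)

lemma has_field_derivative_cos_moment:
  "(cos_moment m has_field_derivative t * cos (real (2 * m + 1) * t)) (at t)"
proof -
  define a where "a = real (2 * m + 1)"
  have "a > 0" by (simp add: a_def)
  then have "((\<lambda>t. t * sin (a * t) / a + (cos (a * t) - 1) / a\<^sup>2) has_field_derivative
      t * cos (a * t)) (at t)"
    by (auto intro!: derivative_eq_intros simp: field_simps power2_eq_square)
  then show ?thesis
    unfolding cos_moment_def[abs_def] a_def .
qed

definition kernel_moment :: "nat \<Rightarrow> real \<Rightarrow> real" where
  "kernel_moment n t = 2 * (\<Sum>m\<le>n. cos_moment m t) - cos_moment n t"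

lemma has_field_derivative_kernel_moment:
  "(kernel_moment n has_field_derivative t * (cos t * dirichlet_kernel n t)) (at t)"
  unfolding kernel_moment_def[abs_def] cos_times_dirichlet_kernel
  by (rule derivative_eq_intros has_field_derivative_cos_moment refl)+
     (simp add: sum_distrib_left algebra_simps)

section \<open>Substitution in a single term\<close>

lemma mult_unit_interval_bounds:
  fixes w x :: real
  assumes "w \<in> {-1..1}" "x \<in> {0..1}"
  shows "-1 \<le> w * x \<and> w * x \<le> 1"
proof -
  have "\<bar>w * x\<bar> \<le> 1"
    unfolding abs_mult using assms by (intro mult_le_one) auto
  then show ?thesis by (simp add: abs_le_iff)
qed

text \<open>This is the substitution \<open>w x = sin t\<close>: since \<open>sin t * dirichlet_kernel n t = sin ((2 n + 1) t)\<close>,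
  the integrand is \<open>arcsin (w x) * sin ((2 n + 1) arcsin (w x)) / x\<close>, in a form that is
  continuous at \<open>x = 0\<close>.\<close>

lemma has_integral_arcsin_kernel:
  fixes w :: real
  assumes w: "w \<in> {-1..1}"
  shows "((\<lambda>x. w * arcsin (w * x) * dirichlet_kernel n (arcsin (w * x)))
           has_integral kernel_moment n (arcsin w)) {0..1}"
proof -
  have range: "-1 \<le> w * x \<and> w * x \<le> 1" if "x \<in> {0..1}" for x
    using mult_unit_interval_bounds w that by blast
  have range': "-1 < w * x \<and> w * x < 1" if "x \<in> {0<..<1}" for x
  proof -
    have "\<bar>w * x\<bar> \<le> \<bar>x\<bar>"
      using mult_right_mono[of "\<bar>w\<bar>" 1 "\<bar>x\<bar>"] w by (auto simp: abs_mult)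
    with that show ?thesis by auto
  qed
  have cont: "continuous_on {0..1} (\<lambda>x. kernel_moment n (arcsin (w * x)))"
  proof (rule continuous_on_compose2[of UNIV "kernel_moment n"])
    show "continuous_on UNIV (kernel_moment n)"
      using has_field_derivative_kernel_moment DERIV_isCont
      by (metis continuous_at_imp_continuous_on)
    show "continuous_on {0..1} (\<lambda>x. arcsin (w * x))"
      using range by (intro continuous_intros) auto
  qed auto
  have "((\<lambda>x. kernel_moment n (arcsin (w * x))) has_vector_derivative
      w * arcsin (w * x) * dirichlet_kernel n (arcsin (w * x))) (at x)"
    if x: "x \<in> {0<..<1}" for x
  proof -
    define c where "c = cos (arcsin (w * x))"
    have r: "-1 < w * x" "w * x < 1" using range'[OF x] by auto
    have c: "c \<noteq> 0" "inverse (sqrt (1 - (w * x)\<^sup>2)) = inverse c"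
      using cos_arcsin_nonzero[OF r] cos_arcsin[of "w * x"] r by (auto simp: c_def)
    have "((\<lambda>x. arcsin (w * x)) has_field_derivative inverse c * w) (at x)"
      using r by (auto intro!: derivative_eq_intros simp: c)
    from DERIV_chain2[OF has_field_derivative_kernel_moment this, of n]
    have "((\<lambda>x. kernel_moment n (arcsin (w * x))) has_field_derivative
        w * arcsin (w * x) * dirichlet_kernel n (arcsin (w * x))) (at x)"
      \<comment> \<open>The factor \<open>cos (arcsin (w * x))\<close> of the moment's derivative
        cancels the derivative of \<open>arcsin\<close>.\<close>
      by (rule back_subst[of "\<lambda>d. (_ has_field_derivative d) _"]) (use c(1) in \<open>simp flip: c_def\<close>)
    then show ?thesis
      by (simp add: has_real_derivative_iff_has_vector_derivative)
  qed
  \<comment> \<open>If \<open>w\<close> is \<open>1\<close> or \<open>-1\<close>, then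
    \<open>arcsin (w * x)\<close> is not differentiable at \<open>x = 1\<close>, hence the version
    that asks only for continuity at the endpoints.\<close>
  from fundamental_theorem_of_calculus_interior[OF _ cont this]
  show ?thesis by (simp add: kernel_moment_def)
qed

section \<open>Sine series of the arctangent\<close>

text \<open>Up to sign, \<open>Re (Arctan z)\<close> is half the argument of
  \<open>(1 - \<i> * z) / (1 + \<i> * z)\<close>, and this Moebius map sends the unit disc into the
  right half-plane.\<close>

lemma abs_Re_Arctan_lt:
  assumes "norm z < 1"
  shows "\<bar>Re (Arctan z)\<bar> < pi / 4"
proof -
  have nz: "1 + \<i> * z \<noteq> 0"
    using assms by (metis add_eq_0_iff norm_ii norm_minus_cancel norm_mult norm_one
        mult_1 less_irrefl)
  have "(Re z)\<^sup>2 + (Im z)\<^sup>2 < 1"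
    using assms by (simp add: cmod_def)
  then have "Re ((1 - \<i> * z) * cnj (1 + \<i> * z)) > 0"
    by (simp add: algebra_simps power2_eq_square)
  then have "Re ((1 - \<i> * z) / (1 + \<i> * z)) > 0"
    using nz by (simp add: Re_complex_div_gt_0)
  then have "\<bar>Im (Ln ((1 - \<i> * z) / (1 + \<i> * z)))\<bar> < pi / 2"
    by (rule Re_Ln_pos_lt_imp)
  then show ?thesis by (simp add: Arctan_def)
qed

text \<open>Both sides have the same tangent, and the bound \<open>pi / 4\<close> on each summand
  keeps the sum in the strip where \<open>Arctan\<close> inverts \<open>tan\<close>, so no multiple
  of \<open>pi\<close> appears.\<close>

lemma Arctan_add:
  assumes "norm a < 1" "norm b < 1"
  shows "Arctan a + Arctan b = Arctan ((a + b) / (1 - a * b))"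
proof -
  have sq: "z\<^sup>2 \<noteq> -1" if "norm z < 1" for z :: complex
    using that by (metis abs_norm_cancel abs_square_less_1 less_irrefl norm_minus_cancel
        norm_one norm_power)
  have tan: "tan (Arctan a) = a" "tan (Arctan b) = b"
    using assms sq by (auto intro: tan_Arctan)
  have cos0: "cos (Arctan z) \<noteq> 0" if "norm z < 1" for z
  proof
    assume *: "cos (Arctan z) = 0"
    \<comment> \<open>Division by zero gives \<open>tan (Arctan z) = 0\<close> here.\<close>
    then have "z = 0" using tan_Arctan[OF sq[OF that]] by (simp add: tan_def)
    with * show False by simp
  qed
  have "norm (a * b) < 1"
    using assms by (metis norm_ge_zero norm_mult mult_strict_mono mult_1 zero_less_one)
  then have "1 - a * b \<noteq> 0" by auto
  then have "cos (Arctan a + Arctan b) \<noteq> 0"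
    using lemma_tan_add1[of "Arctan a" "Arctan b"] cos0 assms tan by auto
  then have "tan (Arctan a + Arctan b) = (a + b) / (1 - a * b)"
    using tan_add[of "Arctan a" "Arctan b"] cos0 assms tan by simp
  moreover have "\<bar>Re (Arctan a + Arctan b)\<bar> < pi / 2"
    using abs_Re_Arctan_lt[OF assms(1)] abs_Re_Arctan_lt[OF assms(2)]
    unfolding plus_complex.sel by linarith
  ultimately show ?thesis by (metis Arctan_tan)
qed

text \<open>Writing the sine by exponentials splits the series into the Taylor series of
  \<open>Arctan\<close> at two points \<open>a\<close> and \<open>b\<close> with
  \<open>a + b = 2 * R * sin t\<close> and \<open>a * b = R\<^sup>2\<close>.\<close>

lemma Arctan_sin_sums:
  fixes R :: complex and t :: real
  assumes R: "norm R < 1"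
  shows "(\<lambda>n. 2 * R ^ (2 * n + 1) / of_nat (2 * n + 1) * of_real (sin (real (2 * n + 1) * t)))
           sums Arctan (2 * R / (1 - R\<^sup>2) * of_real (sin t))"
proof -
  define a where "a = - \<i> * R * cis t"
  define b where "b = \<i> * R * cis (- t)"
  have n: "norm a < 1" "norm b < 1" using R by (simp_all add: a_def b_def norm_mult)
  have eq: "(-1) ^ n / of_nat (2 * n + 1) * a ^ (2 * n + 1)
      + (-1) ^ n / of_nat (2 * n + 1) * b ^ (2 * n + 1)
    = 2 * R ^ (2 * n + 1) / of_nat (2 * n + 1) * of_real (sin (real (2 * n + 1) * t))" for n
  proof -
    \<comment> \<open>The odd powers of the imaginary unit cancel the alternating sign of the Taylor
      series.\<close>
    have i: "\<i> ^ (2 * n + 1) = \<i> * (-1) ^ n" "(- \<i>) ^ (2 * n + 1) = - \<i> * (-1) ^ n"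
      by (simp_all add: power_mult)
    have pw: "(x * y * z) ^ k = x ^ k * y ^ k * z ^ k" for x y z :: complex and k
      by (simp add: power_mult_distrib)
    have s: "cis (real (2 * n + 1) * - t) - cis (real (2 * n + 1) * t)
        = - 2 * \<i> * of_real (sin (real (2 * n + 1) * t))"
      by (simp add: complex_eq_iff)
    have "a ^ (2 * n + 1) + b ^ (2 * n + 1)
        = \<i> * (-1) ^ n * R ^ (2 * n + 1)
          * (cis (real (2 * n + 1) * - t) - cis (real (2 * n + 1) * t))"
      unfolding a_def b_def pw i Complex.DeMoivre by (simp add: algebra_simps)
    also have "\<dots> = 2 * ((-1) ^ n * R ^ (2 * n + 1) * of_real (sin (real (2 * n + 1) * t)))"
      unfolding s by (simp add: algebra_simps)
    finally have "(-1) ^ n * (a ^ (2 * n + 1) + b ^ (2 * n + 1))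
        = ((-1) ^ n * (-1) ^ n) * (2 * R ^ (2 * n + 1) * of_real (sin (real (2 * n + 1) * t)))"
      by (simp only: mult_ac)
    then have "(-1) ^ n * (a ^ (2 * n + 1) + b ^ (2 * n + 1))
        = 2 * R ^ (2 * n + 1) * of_real (sin (real (2 * n + 1) * t))"
      by (simp flip: power_mult_distrib)
    then show ?thesis
      by (simp only: add_divide_distrib[symmetric] distrib_left times_divide_eq_left)
  qed
  have "a + b = 2 * R * of_real (sin t)"
    by (simp add: a_def b_def complex_eq_iff)
  moreover have "a * b = - (\<i> * \<i>) * R\<^sup>2 * (cis t * cis (- t))"
    unfolding a_def b_def power2_eq_square by (simp only: mult_ac mult_minus_left mult_minus_right)
  then have "a * b = R\<^sup>2" by (simp add: cis_mult)
  ultimately have "Arctan a + Arctan b = Arctan (2 * R / (1 - R\<^sup>2) * of_real (sin t))"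
    by (simp add: Arctan_add[OF n])
  with sums_add[OF Arctan_series(2)[OF n(1)] Arctan_series(2)[OF n(2)]]
  show ?thesis unfolding eq by simp
qed

section \<open>Termwise integration\<close>

text \<open>The kernel is at most \<open>2 n + 1\<close>, which cancels the denominator; the
  geometric majorant \<open>2 * pi * norm R ^ (2 * n + 1)\<close> then gives uniform convergence on
  the whole interval.\<close>

lemma TS_sums:
  fixes w :: real and R :: complex
  assumes w: "w \<in> {-1..1}" "w \<noteq> 0" and R: "norm R < 1"
    and v: "v / of_real w = 2 * R / (1 - R\<^sup>2)"
  shows "(\<lambda>n. 2 * R ^ (2 * n + 1) / of_nat (2 * n + 1) * of_real (kernel_moment n (arcsin w)))
           sums TS v (of_real w)"
proof -
  define g where "g n x = w * arcsin (w * x) * dirichlet_kernel n (arcsin (w * x))" for n x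
  define f where
    "f n x = 2 * R ^ (2 * n + 1) / of_nat (2 * n + 1) * complex_of_real (g n x)" for n x
  have range: "-1 \<le> w * x \<and> w * x \<le> 1" if "x \<in> {0..1}" for x
    using mult_unit_interval_bounds w that by blast
  have ptw: "(\<lambda>n. f n x) sums (Arctan (v * of_real x) * Arcsin (of_real w * of_real x) / of_real x)"
    if x: "x \<in> {0..1}" for x
  proof (cases "x = 0")
    \<comment> \<open>Here \<open>arcsin 0 = 0\<close> makes each term zero, in agreement with the
      value \<open>0 / 0 = 0\<close> of the integrand.\<close>
    case True
    then show ?thesis by (simp add: f_def g_def)
  next
    case False
    define t where "t = arcsin (w * x)"
    have t: "sin t = w * x" "Arcsin (of_real w * of_real x) = of_real t"
      using range[OF x] of_real_arcsin[of "w * x"] by (auto simp: t_def)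
    have vx: "2 * R / (1 - R\<^sup>2) * of_real (sin t) = v * of_real x"
      using w by (simp add: t flip: v)
    have "f n x = 2 * R ^ (2 * n + 1) / of_nat (2 * n + 1) * of_real (sin (real (2 * n + 1) * t))
        * (of_real t / of_real x)" for n
    proof -
      have "g n x = sin (real (2 * n + 1) * t) * (t / x)"
        unfolding sin_times_dirichlet_kernel[symmetric] t(1) g_def t_def[symmetric]
        using False by simp
      then show ?thesis by (simp add: f_def)
    qed
    with sums_mult2[OF Arctan_sin_sums[OF R, of t], of "of_real t / of_real x"]
    show ?thesis by (simp only: vx t(2) times_divide_eq_right)
  qed
  have bound: "norm (f n x) \<le> 2 * pi * norm R ^ (2 * n + 1)" if x: "x \<in> {0..1}" for n x
  proof -
    define d where "d = real (2 * n + 1)"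
    have d: "d > 0" by (simp add: d_def)
    have "\<bar>arcsin (w * x)\<bar> \<le> pi"
      using arcsin_bounded[of "w * x"] range[OF x] by auto
    then have "\<bar>w\<bar> * \<bar>arcsin (w * x)\<bar> * \<bar>dirichlet_kernel n (arcsin (w * x))\<bar> \<le> 1 * pi * d"
      using w unfolding d_def by (intro mult_mono abs_dirichlet_kernel_le) auto
    then have "\<bar>g n x\<bar> \<le> pi * d" by (simp add: g_def abs_mult)
    then have "2 * norm R ^ (2 * n + 1) / d * \<bar>g n x\<bar> \<le> 2 * norm R ^ (2 * n + 1) / d * (pi * d)"
      using d by (intro mult_left_mono) auto
    also have "\<dots> = 2 * pi * norm R ^ (2 * n + 1)"
      using d by simp
    finally show ?thesis
      unfolding f_def d_def norm_mult norm_divide norm_power norm_of_nat norm_of_real by simp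
  qed
  have "summable (\<lambda>n. (2 * pi * norm R) * ((norm R)\<^sup>2) ^ n)"
    using R by (intro summable_mult summable_geometric) (simp add: abs_square_less_1)
  then have "summable (\<lambda>n. 2 * pi * norm R ^ (2 * n + 1))"
    unfolding power_add power_mult by (simp only: power_one_right mult_ac)
  then have ul: "uniform_limit {0..1} (\<lambda>N x. \<Sum>n<N. f n x) (\<lambda>x. \<Sum>n. f n x) sequentially"
    by (rule Weierstrass_m_test[rotated]) (use bound in auto)
  have "continuous_on {0..1} (\<lambda>x. \<Sum>n<N. f n x)" for N
    unfolding f_def g_def by (intro continuous_intros) (use range in auto)
  from uniform_limit_integral[OF ul this sequentially_bot]
  obtain I J where I: "\<And>N. ((\<lambda>x. \<Sum>n<N. f n x) has_integral I N) {0..1}"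
    and J: "((\<lambda>x. \<Sum>n. f n x) has_integral J) {0..1}" and IJ: "I \<longlonglongrightarrow> J"
    by blast
  have "(f n has_integral 2 * R ^ (2 * n + 1) / of_nat (2 * n + 1)
      * of_real (kernel_moment n (arcsin w))) {0..1}" for n
    unfolding f_def[abs_def] g_def
    by (intro has_integral_mult_right has_integral_of_real has_integral_arcsin_kernel w)
  then have "I = (\<lambda>N. \<Sum>n<N. 2 * R ^ (2 * n + 1) / of_nat (2 * n + 1)
      * of_real (kernel_moment n (arcsin w)))"
    by (intro ext has_integral_unique[OF I] has_integral_sum) auto
  with IJ have "(\<lambda>n. 2 * R ^ (2 * n + 1) / of_nat (2 * n + 1)
      * of_real (kernel_moment n (arcsin w))) sums J"
    unfolding sums_def by simp
  moreover have "J = TS v (of_real w)"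
  proof -
    have "((\<lambda>x. Arctan (v * of_real x) * Arcsin (of_real w * of_real x) / of_real x)
        has_integral J) {0..1}"
      by (rule has_integral_eq[OF _ J]) (use ptw sums_unique in fastforce)
    then show ?thesis
      unfolding TS_def by (rule integral_unique[symmetric])
  qed
  ultimately show ?thesis by simp
qed

section \<open>Convergence of the single and double series\<close>

lemma norm_divide_odd_power_le:
  "norm (z / of_nat (2 * n + 1) ^ j :: complex) \<le> norm z"
proof -
  have "(1 :: real) \<le> real (2 * n + 1) ^ j" by (rule one_le_power) simp
  moreover have "norm (of_nat (2 * n + 1) ^ j :: complex) = real (2 * n + 1) ^ j"
    unfolding norm_power norm_of_nat ..
  ultimately show ?thesis
    unfolding norm_divide
    using divide_left_mono[of 1 "real (2 * n + 1) ^ j" "norm z"] by simp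
qed

lemma F_sums:
  assumes "norm x < 1"
  shows "(\<lambda>n. x ^ (2 * n + 1) / of_nat (2 * n + 1) ^ j) sums F j x"
proof -
  have "summable (\<lambda>n. norm x * ((norm x)\<^sup>2) ^ n)"
    using assms by (intro summable_mult summable_geometric) (simp add: abs_square_less_1)
  then have "summable (\<lambda>n. norm x ^ (2 * n + 1))"
    unfolding power_add power_mult by (simp only: power_one_right mult.commute)
  then have "summable (\<lambda>n. x ^ (2 * n + 1) / of_nat (2 * n + 1) ^ j)"
    by (rule summable_comparison_test'[of _ 0])
       (metis norm_divide_odd_power_le norm_power)
  then show ?thesis unfolding F_def by (rule summable_sums)
qed

text \<open>The inner sum has \<open>n + 1\<close> terms of norm at most \<open>1\<close>, so the
  differentiated geometric series is a majorant. The circle \<open>norm y = 1\<close> is included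
  because \<open>1\<close>, \<open>S\<close> and \<open>1 / S\<close> lie on it.\<close>

lemma FF_sums:
  assumes x: "norm x < 1" and y: "norm y \<le> 1"
  shows "(\<lambda>n. x ^ (2 * n + 1) / of_nat (2 * n + 1) ^ j *
     (\<Sum>m\<le>n. y ^ (2 * m + 1) / of_nat (2 * m + 1) ^ k)) sums FF j k x y"
proof -
  have "summable (\<lambda>n. norm x * (of_nat (Suc n) * ((norm x)\<^sup>2) ^ n))"
    using x by (intro summable_mult sums_summable[OF geometric_deriv_sums])
      (simp add: abs_square_less_1)
  then have s: "summable (\<lambda>n. norm x ^ (2 * n + 1) * real (Suc n))"
    unfolding power_add power_mult by (simp only: power_one_right mult_ac)
  have "norm (x ^ (2 * n + 1) / of_nat (2 * n + 1) ^ j *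
     (\<Sum>m\<le>n. y ^ (2 * m + 1) / of_nat (2 * m + 1) ^ k)) \<le> norm x ^ (2 * n + 1) * real (Suc n)" for n
  proof -
    have "norm (\<Sum>m\<le>n. y ^ (2 * m + 1) / of_nat (2 * m + 1) ^ k) \<le> (\<Sum>m\<le>n. 1)"
    proof (rule sum_norm_le)
      fix m
      have "norm (y ^ (2 * m + 1)) \<le> 1"
        unfolding norm_power using y by (intro power_le_one) auto
      then show "norm (y ^ (2 * m + 1) / of_nat (2 * m + 1) ^ k) \<le> 1"
        using norm_divide_odd_power_le order_trans by blast
    qed
    moreover have "norm (x ^ (2 * n + 1) / of_nat (2 * n + 1) ^ j) \<le> norm x ^ (2 * n + 1)"
      by (metis norm_divide_odd_power_le norm_power)
    ultimately show ?thesis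
      unfolding norm_mult by (intro mult_mono) auto
  qed
  then have "summable (\<lambda>n. x ^ (2 * n + 1) / of_nat (2 * n + 1) ^ j *
     (\<Sum>m\<le>n. y ^ (2 * m + 1) / of_nat (2 * m + 1) ^ k))"
    by (intro summable_comparison_test'[OF s, of 0]) auto
  then show ?thesis unfolding FF_def by (rule summable_sums)
qed

text \<open>Euler's formulas; with \<open>S = cis t\<close> they produce the arguments
  \<open>S\<close> and \<open>1 / S\<close> of the claim.\<close>

lemma of_real_cos_moment:
  "complex_of_real (cos_moment m t) =
     of_real t * (cis t ^ (2 * m + 1) - (1 / cis t) ^ (2 * m + 1)) / (2 * \<i> * of_nat (2 * m + 1))
     + (cis t ^ (2 * m + 1) + (1 / cis t) ^ (2 * m + 1) - 2) / (2 * of_nat (2 * m + 1) ^ 2)"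
proof -
  define a where "a = real (2 * m + 1)"
  have p: "cis t ^ (2 * m + 1) = cis (a * t)" "(1 / cis t) ^ (2 * m + 1) = cis (- (a * t))"
    unfolding divide_inverse a_def mult_1_left cis_inverse Complex.DeMoivre by simp_all
  have sc: "cis (a * t) - cis (- (a * t)) = 2 * \<i> * of_real (sin (a * t))"
    "cis (a * t) + cis (- (a * t)) = 2 * of_real (cos (a * t))"
    by (simp_all add: complex_eq_iff)
  have a: "of_nat (2 * m + 1) = complex_of_real a" "a \<noteq> 0" by (simp_all add: a_def)
  show ?thesis
    unfolding p a sc cos_moment_def a_def[symmetric] using a(2) by (simp add: field_simps)
qed

section \<open>The half-angle parameter\<close>

text \<open>With \<open>s\<close> the square root, \<open>R\<^sup>2 = (s - 1) / (1 + s)\<close>. Off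
  the excluded rays \<open>s\<close> lies in the open right half-plane, hence nearer to
  \<open>1\<close> than to \<open>-1\<close>.\<close>

lemma half_angle_parameter:
  fixes q R :: complex
  assumes q: "q \<notin> {\<i> * of_real t | t :: real. \<bar>t\<bar> \<ge> 1}"
    and R: "R = q / (1 + csqrt (1 + q\<^sup>2))"
  shows "norm R < 1" "q = 2 * R / (1 - R\<^sup>2)"
proof -
  define s where "s = csqrt (1 + q\<^sup>2)"
  have s2: "s\<^sup>2 = 1 + q\<^sup>2" by (simp add: s_def)
  \<comment> \<open>A purely imaginary \<open>s\<close> would make \<open>1 + q\<^sup>2\<close> real
    and nonpositive, putting \<open>q\<close> on an excluded ray.\<close>
  have "Re s \<noteq> 0"
  proof
    assume "Re s = 0"
    then have "s\<^sup>2 = - of_real ((Im s)\<^sup>2)"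
      by (simp add: complex_eq_iff power2_eq_square)
    moreover have "q\<^sup>2 = s\<^sup>2 - 1" by (simp add: s2)
    ultimately have q2: "q\<^sup>2 = - of_real (1 + (Im s)\<^sup>2)"
      by simp
    define t where "t = sqrt (1 + (Im s)\<^sup>2)"
    have t: "t\<^sup>2 = 1 + (Im s)\<^sup>2" "t \<ge> 1" by (simp_all add: t_def)
    have "q\<^sup>2 = (\<i> * of_real t)\<^sup>2"
      using q2 t(1) by (simp add: power_mult_distrib flip: of_real_power)
    then have "q = \<i> * of_real t \<or> q = \<i> * of_real (- t)"
      by (auto simp: power2_eq_iff)
    moreover have "q \<noteq> \<i> * of_real u" if "\<bar>u\<bar> \<ge> 1" for u
      using q that by blast
    ultimately show False
      using t(2) by (metis abs_of_nonneg abs_minus_cancel order_trans zero_le_one)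
  qed
  then have Re: "Re s > 0" using Re_csqrt[of "1 + q\<^sup>2"] by (simp add: s_def del: csqrt.simps)
  then have nz: "1 + s \<noteq> 0" "s \<noteq> 0"
    by (auto simp: complex_eq_iff)
  have Rs: "R = q / (1 + s)" by (simp add: R s_def)
  have "q\<^sup>2 = (s - 1) * (1 + s)" using s2 by (simp add: algebra_simps power2_eq_square)
  then have R2: "R\<^sup>2 = (s - 1) / (1 + s)"
    using nz by (simp add: Rs power_divide power2_eq_square)
  have "(norm (s - 1))\<^sup>2 < (norm (1 + s))\<^sup>2"
    unfolding cmod_power2 using Re by (simp add: power2_eq_square algebra_simps)
  then have "norm (s - 1) < norm (1 + s)"
    by (rule power_less_imp_less_base) simp
  then have "norm (R\<^sup>2) < 1"
    using nz by (simp add: R2 norm_divide divide_less_eq_1)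
  then show "norm R < 1"
    by (simp add: norm_power abs_square_less_1)
  have "1 - R\<^sup>2 = 2 / (1 + s)" using nz by (simp add: R2 field_simps)
  then show "q = 2 * R / (1 - R\<^sup>2)" using nz by (simp add: Rs)
qed

section \<open>Comparison of coefficients\<close>

theorem theorem3p5:
  fixes w :: real and v R S :: complex
  assumes "w \<in> {-1..1}" and "w \<noteq> 0"
    and "v / of_real w \<notin> {\<i> * of_real t | t :: real. \<bar>t\<bar> \<ge> 1}"
    and "R = (v / of_real w) / (1 + csqrt (1 + (v / of_real w)\<^sup>2))"
    and "S = \<i> * of_real w + csqrt (1 - (of_real w)\<^sup>2)"
  shows "TS v (of_real w) =
      2 * F 3 R - F 3 (R * S) - F 3 (R / S)
      - 4 * FF 1 2 R 1 + 2 * FF 1 2 R S + 2 * FF 1 2 R (1 / S)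
      + \<i> * Arcsin (of_real w) *
        (F 2 (R * S) - F 2 (R / S) - 2 * FF 1 1 R S + 2 * FF 1 1 R (1 / S))"
proof -
  define t where "t = arcsin w"
  have w2: "w\<^sup>2 \<le> 1" using assms(1) by (auto simp: abs_square_le_1)
  have "csqrt (1 - (of_real w)\<^sup>2) = csqrt (of_real (1 - w\<^sup>2))" by simp
  also have "\<dots> = of_real (sqrt (1 - w\<^sup>2))" using w2 by (intro csqrt_of_real) simp
  finally have S: "S = cis t"
    using assms(1) by (simp add: assms(5) t_def cos_arcsin complex_eq_iff)
  have At: "Arcsin (of_real w) = of_real t"
    unfolding t_def using assms(1) by (intro of_real_arcsin[symmetric]) auto
  have R: "norm R < 1" "v / of_real w = 2 * R / (1 - R\<^sup>2)"
    using half_angle_parameter[OF assms(3,4)] by auto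
  have nS: "norm S = 1" "norm (1 / S) = 1" by (simp_all add: S norm_divide)
  have RS: "norm (R * S) < 1" "norm (R / S) < 1"
    using R(1) nS by (simp_all add: norm_mult norm_divide)
  let ?p = "\<lambda>x n. x ^ (2 * n + 1) :: complex"
  let ?d = "\<lambda>n. of_nat (2 * n + 1) :: complex"
  let ?i = "\<lambda>k y n. \<Sum>m\<le>n. ?p y m / ?d m ^ k"
  \<comment> \<open>The part \<open>2 * (\<Sum>m\<le>n. cos_moment m t)\<close> of the moment yields
    the double series; the part \<open>- cos_moment n t\<close> yields the single ones, where powers
    of \<open>R\<close> and \<open>S\<close> merge into those of \<open>R * S\<close> and
    \<open>R / S\<close>.\<close>
  have eq: "2 * ?p R n / ?d n * of_real (kernel_moment n t) =
      2 * (?p R n / ?d n ^ 3) - ?p (R * S) n / ?d n ^ 3 - ?p (R / S) n / ?d n ^ 3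
      - 4 * (?p R n / ?d n ^ 1 * ?i 2 1 n) + 2 * (?p R n / ?d n ^ 1 * ?i 2 S n)
      + 2 * (?p R n / ?d n ^ 1 * ?i 2 (1 / S) n)
      + \<i> * of_real t *
        (?p (R * S) n / ?d n ^ 2 - ?p (R / S) n / ?d n ^ 2
          - 2 * (?p R n / ?d n ^ 1 * ?i 1 S n) + 2 * (?p R n / ?d n ^ 1 * ?i 1 (1 / S) n))" for n
  proof -
    define T where "T = 1 / S"
    \<comment> \<open>The constant of \<open>cos_moment\<close> is written with a power of
      \<open>1\<close>, so that its sum becomes the inner sum of \<open>FF 1 2 R 1\<close>.\<close>
    have cm: "complex_of_real (cos_moment m t) =
        - \<i> * of_real t / 2 * (?p S m / ?d m ^ 1) + \<i> * of_real t / 2 * (?p T m / ?d m ^ 1)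
        + 1 / 2 * (?p S m / ?d m ^ 2) + 1 / 2 * (?p T m / ?d m ^ 2) - ?p 1 m / ?d m ^ 2" for m
    proof -
      define d where "d = ?d m"
      have "d \<noteq> 0" unfolding d_def of_nat_eq_0_iff by simp
      then show ?thesis
        unfolding of_real_cos_moment S[symmetric] T_def[symmetric] power_one d_def[symmetric]
        by (simp add: field_simps power2_eq_square del: power_Suc)
    qed
    have sm: "(\<Sum>m\<le>n. complex_of_real (cos_moment m t)) =
        - \<i> * of_real t / 2 * ?i 1 S n + \<i> * of_real t / 2 * ?i 1 T n
        + 1 / 2 * ?i 2 S n + 1 / 2 * ?i 2 T n - ?i 2 1 n"
      unfolding cm by (simp only: sum.distrib sum_subtractf sum_distrib_left)
    have km: "complex_of_real (kernel_moment n t)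
        = 2 * (\<Sum>m\<le>n. complex_of_real (cos_moment m t)) - complex_of_real (cos_moment n t)"
      by (simp add: kernel_moment_def)
    have RT: "R / S = R * T" by (simp add: T_def)
    define d where "d = ?d n"
    have "d \<noteq> 0" unfolding d_def of_nat_eq_0_iff by simp
    then show ?thesis
      unfolding km sm unfolding cm T_def[symmetric] RT power_mult_distrib power_one d_def[symmetric]
      by (simp add: field_simps power2_eq_square power3_eq_cube)
  qed
  show ?thesis
    unfolding At
    by (rule sums_unique2[OF TS_sums[OF assms(1,2) R, folded t_def, unfolded eq]])
       (intro sums_add sums_diff sums_mult F_sums FF_sums R RS; simp add: nS)
qed

end
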